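(* Let $f:\mathbb{R}^n\to\overline{\mathbb{R}}$ and $g:\mathbb{R}^m\to\overline{\mathbb{R}}$ be proper, convex, lower semicontinuous functions, $A:\mathbb{R}^n\to\mathbb{R}^m$ a linear operator, $M_1\in\mathbb{R}^{n\times n}$ and $M_2\in\mathbb{R}^{m\times m}$ symmetric positive semidefinite matrices, and $c>0$. Let $(x^*,z^*,y^* )\in\mathbb{R}^n\times\mathbb{R}^m\times\mathbb{R}^m$ be a saddle point of the Lagrangian $l(x,z,y)=f(x)+g(z)+\langle y,Ax-z\rangle$, and let $(x^k,z^k,y^k)_{k\ge 0}$ be a sequence generated by the alternating direction proximal method of multipliers described in the context. Define $$v^{k+1}:=\|x^{k+1}-x^k\|_{M_1}^2+\|z^{k+1}-z^k\|^2_{M_2+c\,\mathrm{Id}}+c^{-1}\|y^{k+1}-y^k\|^2 \quad \forall k\ge 0$$ and $$u^k:=\|x^*-x^k\|_{M_1}^2+\|z^*-z^k\|_{M_2+c\,\mathrm{Id}}^2+c^{-1}\|y^*-y^k\|^2+\|z^k-z^{k-1}\|_{M_2}^2 \quad \forall k\ge 1.$$ Then $$v^{k+1}\le u^k-u^{k+1}\quad \forall k\ge 1.$$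
   Context: Here $\overline{\mathbb{R}}=\mathbb{R}\cup\{\pm\infty\}$; $\mathbb{R}^n$ and $\mathbb{R}^m$ carry the usual inner products $\langle\cdot,\cdot\rangle$ and induced norms $\|\cdot\|$; $\mathrm{Id}$ is the identity matrix; for a symmetric positive semidefinite matrix $M$, $\|u\|_M^2=\langle u,Mu\rangle$. A point $(x^*,z^*,y^* )$ is a saddle point of $l$ if $l(x^*,z^*,y)\le l(x^*,z^*,y^* )\le l(x,z,y^* )$ for all $(x,z,y)\in\mathbb{R}^n\times\mathbb{R}^m\times\mathbb{R}^m$. Alternating direction proximal method of multipliers: choose $(x^0,z^0,y^0)\in\mathbb{R}^n\times\mathbb{R}^m\times\mathbb{R}^m$ and $c>0$, and for all $k\ge0$ let $$x^{k+1}\in\operatorname{argmin}_{x\in\mathbb{R}^n}\left\{f(x)+\frac{c}{2}\|Ax-z^k+c^{-1}y^k\|^2+\frac12\|x-x^k\|_{M_1}^2\right\},$$ $$z^{k+1}=\operatorname{argmin}_{z\in\mathbb{R}^m}\left\{g(z)+\frac{c}{2}\|Ax^{k+1}-z+c^{-1}y^k\|^2+\frac12\|z-z^k\|_{M_2}^2\right\},$$ $$y^{k+1}=y^k+c(Ax^{k+1}-z^{k+1}).$$ (The set of minimizers defining $x^{k+1}$ need not be a singleton; "a sequence generated" means any sequence satisfying these relations for all $k\ge0$.) *)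

theory Defs
  imports "HOL-Analysis.Analysis"
begin

definition proper_fun :: "('a \<Rightarrow> ereal) \<Rightarrow> bool" where
  "proper_fun f \<longleftrightarrow> (\<forall>x. f x \<noteq> -\<infinity>) \<and> (\<exists>x. f x \<noteq> \<infinity>)"

(* The conventions of ereal are those of convex analysis: \<infinity> + (-\<infinity>) = \<infinity> and 0 * \<infinity> = 0. *)
definition convex_ereal :: "('a::real_vector \<Rightarrow> ereal) \<Rightarrow> bool" where
  "convex_ereal f \<longleftrightarrow> (\<forall>x y. \<forall>u\<ge>0. \<forall>v\<ge>0. u + v = 1 \<longrightarrow>
     f (u *\<^sub>R x + v *\<^sub>R y) \<le> ereal u * f x + ereal v * f y)"

definition lower_semicontinuous :: "('a::topological_space \<Rightarrow> ereal) \<Rightarrow> bool" where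
  "lower_semicontinuous f \<longleftrightarrow> (\<forall>x. f x \<le> Liminf (at x) f)"

definition sym_pos_semidef :: "real^'n^'n \<Rightarrow> bool" where
  "sym_pos_semidef M \<longleftrightarrow> transpose M = M \<and> (\<forall>u. 0 \<le> u \<bullet> (M *v u))"

(* The squared seminorm induced by M. *)
definition sqnorm :: "real^'n^'n \<Rightarrow> real^'n \<Rightarrow> real" where
  "sqnorm M u = u \<bullet> (M *v u)"

definition argmin :: "('a \<Rightarrow> ereal) \<Rightarrow> 'a set" where
  "argmin \<phi> = {x. is_arg_min \<phi> (\<lambda>_. True) x}"

definition lagrangian ::
  "(real^'n \<Rightarrow> ereal) \<Rightarrow> (real^'m \<Rightarrow> ereal) \<Rightarrow> (real^'n \<Rightarrow> real^'m)
    \<Rightarrow> real^'n \<Rightarrow> real^'m \<Rightarrow> real^'m \<Rightarrow> ereal" where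
  "lagrangian f g A x z y = f x + g z + ereal (y \<bullet> (A x - z))"

definition saddle_point ::
  "('a \<Rightarrow> 'b \<Rightarrow> 'c \<Rightarrow> ereal) \<Rightarrow> 'a \<Rightarrow> 'b \<Rightarrow> 'c \<Rightarrow> bool" where
  "saddle_point l xs zs ys \<longleftrightarrow>
     (\<forall>x z y. l xs zs y \<le> l xs zs ys \<and> l xs zs ys \<le> l x z ys)"

(* Sequences generated by the alternating direction proximal method of multipliers.
   The x-update selects an arbitrary minimizer; the objective of the z-update is strongly
   convex, so its set of minimizers is a singleton. *)
definition adpmm_sequence ::
  "(real^'n \<Rightarrow> ereal) \<Rightarrow> (real^'m \<Rightarrow> ereal) \<Rightarrow> (real^'n \<Rightarrow> real^'m)
    \<Rightarrow> real^'n^'n \<Rightarrow> real^'m^'m \<Rightarrow> real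
    \<Rightarrow> (nat \<Rightarrow> real^'n) \<Rightarrow> (nat \<Rightarrow> real^'m) \<Rightarrow> (nat \<Rightarrow> real^'m) \<Rightarrow> bool" where
  "adpmm_sequence f g A M1 M2 c x z y \<longleftrightarrow> (\<forall>k.
     x (k + 1) \<in> argmin (\<lambda>\<xi>. f \<xi> + ereal (c / 2 * (norm (A \<xi> - z k + inverse c *\<^sub>R y k))\<^sup>2)
                                + ereal (1 / 2 * sqnorm M1 (\<xi> - x k))) \<and>
     {z (k + 1)} = argmin (\<lambda>\<zeta>. g \<zeta> + ereal (c / 2 * (norm (A (x (k + 1)) - \<zeta> + inverse c *\<^sub>R y k))\<^sup>2)
                                + ereal (1 / 2 * sqnorm M2 (\<zeta> - z k))) \<and>
     y (k + 1) = y k + c *\<^sub>R (A (x (k + 1)) - z (k + 1)))"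

end

(* The optimality conditions of the two subproblems and of the saddle point are subgradient
   inclusions for f and g.  Monotonicity of the subdifferential between the iterate and the saddle
   point gives the estimate up to the cross term 2<z^{k+1} - z^k, y^{k+1} - y^k>.  Monotonicity
   for g between two consecutive z-iterates bounds that term from below by
   ||z^{k+1} - z^k||^2 - ||z^k - z^{k-1}||^2 in the M2-seminorm, which is why k >= 1 is needed. *)
theory Submission
  imports Defs
begin

text \<open>Finiteness at \<open>p\<close> is built in, so two subgradient inequalities can be added
  in the reals without cancelling infinite values.\<close>

definition subdifferential :: "('a::real_inner \<Rightarrow> ereal) \<Rightarrow> 'a \<Rightarrow> 'a set" where
  "subdifferential f p =
     {s. \<bar>f p\<bar> \<noteq> \<infinity> \<and> (\<forall>w. f p + ereal (s \<bullet> (w - p)) \<le> f w)}"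

lemma subdifferential_monotone:
  assumes "s \<in> subdifferential f p" and "t \<in> subdifferential f q"
  shows "0 \<le> (s - t) \<bullet> (p - q)"
proof -
  obtain a b where ab: "f p = ereal a" "f q = ereal b"
    using assms by (auto simp: subdifferential_def)
  have "f p + ereal (s \<bullet> (q - p)) \<le> f q" "f q + ereal (t \<bullet> (p - q)) \<le> f p"
    using assms by (auto simp: subdifferential_def)
  then have "a + s \<bullet> (q - p) \<le> b" "b + t \<bullet> (p - q) \<le> a"
    by (simp_all add: ab)
  then show ?thesis
    by (simp add: inner_diff_left inner_diff_right)
qed

lemma argmin_iff: "p \<in> argmin \<phi> \<longleftrightarrow> (\<forall>w. \<phi> p \<le> \<phi> w)"
  by (auto simp: argmin_def is_arg_min_def not_less)

text \<open>Fermat's rule for a convex function plus a differentiable one. Along the segment from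
  \<open>p\<close> to \<open>w\<close>, minimality and convexity bound the difference quotient of
  \<open>q\<close> from below by \<open>f p - f w\<close>; the one-sided limit at \<open>p\<close>
  turns this into the subgradient inequality.\<close>

lemma argmin_add_imp_subgradient:
  fixes f :: "'a::real_inner \<Rightarrow> ereal"
  assumes "proper_fun f" and "convex_ereal f"
    and argmin: "p \<in> argmin (\<lambda>w. f w + ereal (q w))"
    and deriv: "(q has_derivative (\<lambda>h. d \<bullet> h)) (at p)"
  shows "- d \<in> subdifferential f p"
proof -
  have min: "f p + ereal (q p) \<le> f w + ereal (q w)" for w
    using argmin by (simp add: argmin_iff)
  have not_minf: "f w \<noteq> -\<infinity>" for w
    using assms(1) by (simp add: proper_fun_def)
  obtain w0 where "f w0 \<noteq> \<infinity>"
    using assms(1) by (auto simp: proper_fun_def)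
  with min[of w0] have "f p \<noteq> \<infinity>"
    by auto
  with not_minf[of p] obtain a where a: "f p = ereal a"
    by (cases "f p") auto
  have "f p + ereal (- d \<bullet> (w - p)) \<le> f w" for w
  proof (cases "f w")
    case (real b)
    define \<phi> where "\<phi> t = q (p + t *\<^sub>R (w - p))" for t :: real
    have "(\<phi> has_derivative (\<lambda>t. d \<bullet> (t *\<^sub>R (w - p)))) (at 0)"
      unfolding \<phi>_def
      by (rule has_derivative_compose[where g = q])
         (auto intro!: derivative_eq_intros deriv)
    then have "(\<phi> has_real_derivative d \<bullet> (w - p)) (at 0)"
      by (simp add: has_field_derivative_def mult.commute[of _ "d \<bullet> (w - p)"])
    then have lim: "((\<lambda>t. (\<phi> t - \<phi> 0) / t) \<longlongrightarrow> d \<bullet> (w - p)) (at_right 0)"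
      by (auto simp: has_field_derivative_iff intro: tendsto_mono at_le)
    \<comment> \<open>Minimality is tested against the point of the segment at parameter
      \<open>t\<close>; convexity bounds \<open>f\<close> there by the chord, and dividing by
      \<open>t\<close> removes the dependence on \<open>t\<close> from the left-hand side.\<close>
    have "a - b \<le> (\<phi> t - \<phi> 0) / t" if t: "0 < t" "t < 1" for t
    proof -
      have "f ((1 - t) *\<^sub>R p + t *\<^sub>R w) \<le> ereal (1 - t) * f p + ereal t * f w"
        using assms(2) t unfolding convex_ereal_def
        by (metis add_diff_cancel_right' diff_add_cancel diff_ge_0_iff_ge less_eq_real_def)
      moreover have "(1 - t) *\<^sub>R p + t *\<^sub>R w = p + t *\<^sub>R (w - p)"
        by (simp add: algebra_simps)
      ultimately have "f (p + t *\<^sub>R (w - p)) \<le> ereal ((1 - t) * a + t * b)"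
        by (simp add: a real)
      from order_trans[OF min add_right_mono[OF this]]
      have "a + q p \<le> (1 - t) * a + t * b + \<phi> t"
        by (simp add: a \<phi>_def)
      with t show ?thesis
        by (simp add: \<phi>_def field_simps)
    qed
    then have "\<forall>\<^sub>F t in at_right 0. a - b \<le> (\<phi> t - \<phi> 0) / t"
      by (auto simp: eventually_at_right_field intro!: exI[of _ 1])
    then have "a - b \<le> d \<bullet> (w - p)"
      by (intro tendsto_lowerbound[OF lim]) auto
    then show ?thesis
      by (simp add: a real)
  qed (use not_minf in auto)
  then show ?thesis
    by (simp add: subdifferential_def a)
qed

text \<open>Separates the two parts of the z-seminorm in \<open>u\<close> and \<open>v\<close>,
  which have different sources: \<open>M2\<close> enters through the inclusion for \<open>g\<close>,
  the multiple of the identity through that for \<open>f\<close>.\<close>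

lemma sqnorm_add_scaled_id: "sqnorm (M + c *\<^sub>R mat 1) w = sqnorm M w + c * (norm w)\<^sup>2"
  by (simp add: sqnorm_def matrix_vector_mult_add_rdistrib scaleR_matrix_vector_assoc[symmetric]
      inner_add_right power2_norm_eq_inner)

lemma sym_inner_matrix:
  assumes "sym_pos_semidef M"
  shows "a \<bullet> (M *v b) = (M *v a) \<bullet> b"
  by (metis assms dot_lmul_matrix sym_pos_semidef_def transpose_matrix_vector)

lemma matrix_inner_commute:
  assumes "sym_pos_semidef M"
  shows "(M *v a) \<bullet> b = (M *v b) \<bullet> a"
  using sym_inner_matrix[OF assms, of b a] by (simp only: inner_commute)

text \<open>Law of cosines for the seminorm. With \<open>a\<close> the new iterate, \<open>b\<close>
  the old one and \<open>s\<close> the saddle component, it turns an inner product into a step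
  length plus a telescoping difference of distances.\<close>

lemma sqnorm_three_point:
  assumes "sym_pos_semidef M"
  shows "2 * ((M *v (a - b)) \<bullet> (a - s)) = sqnorm M (a - b) + sqnorm M (s - a) - sqnorm M (s - b)"
  by (simp add: sqnorm_def matrix_vector_mult_diff_distrib inner_diff_left inner_diff_right
      sym_inner_matrix[OF assms] matrix_inner_commute[OF assms, of a b]
      matrix_inner_commute[OF assms, of a s] matrix_inner_commute[OF assms, of b s])

lemma norm_three_point:
  fixes a b s :: "'a::real_inner"
  shows "2 * ((a - b) \<bullet> (a - s)) = (norm (a - b))\<^sup>2 + (norm (s - a))\<^sup>2 - (norm (s - b))\<^sup>2"
  by (simp add: power2_norm_eq_inner inner_diff_left inner_diff_right inner_commute)

lemma sqnorm_young:
  assumes "sym_pos_semidef M"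
  shows "2 * ((M *v a) \<bullet> b) \<le> sqnorm M a + sqnorm M b"
proof -
  have "0 \<le> sqnorm M (a - b)"
    using assms by (simp add: sqnorm_def sym_pos_semidef_def)
  then show ?thesis
    by (simp add: sqnorm_def matrix_vector_mult_diff_distrib inner_diff_left inner_diff_right
        sym_inner_matrix[OF assms] matrix_inner_commute[OF assms, of a b])
qed

text \<open>By symmetry the two terms of the product rule coincide, and the factor 1/2 absorbs the
  doubling.\<close>

lemma has_derivative_sqnorm:
  assumes "sym_pos_semidef M"
  shows "((\<lambda>w. 1 / 2 * sqnorm M (w - a)) has_derivative (\<lambda>h. (M *v (p - a)) \<bullet> h)) (at p)"
proof -
  have "((\<lambda>w. w - a) has_derivative (\<lambda>h. h)) (at p)"
    by (auto intro!: derivative_eq_intros)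
  from has_derivative_mult_right[OF has_derivative_inner[OF this
      bounded_linear.has_derivative[OF matrix_vector_mul_bounded_linear this]], of "1 / 2" M]
  show ?thesis
    by (simp add: sqnorm_def sym_inner_matrix[OF assms] matrix_inner_commute[OF assms, of _ "p - a"])
qed

text \<open>Serves both penalty terms: the linear part is \<open>A\<close> in the x-update and
  negation in the z-update.\<close>

lemma has_derivative_half_norm_affine:
  fixes A :: "'a::euclidean_space \<Rightarrow> 'b::euclidean_space"
  assumes "linear A"
  shows "((\<lambda>w. c / 2 * (norm (A w + b))\<^sup>2) has_derivative
           (\<lambda>h. adjoint A (c *\<^sub>R (A p + b)) \<bullet> h)) (at p)"
proof -
  have "((\<lambda>w. A w + b) has_derivative A) (at p)"
    using has_derivative_add_const[OF linear_imp_has_derivative[OF assms]] .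
  from has_derivative_mult_right[OF has_derivative_inner[OF this this], of "c / 2"]
  show ?thesis
    by (simp add: power2_norm_eq_inner adjoint_clauses[OF assms] inner_commute)
qed

lemma saddle_point_optimality:
  assumes "proper_fun f" and "proper_fun g" and "linear A"
    and saddle: "saddle_point (lagrangian f g A) xs zs ys"
  shows "A xs = zs" and "- adjoint A ys \<in> subdifferential f xs" and "ys \<in> subdifferential g zs"
proof -
  have not_minf: "f w \<noteq> -\<infinity>" "g w' \<noteq> -\<infinity>" for w w'
    using assms(1,2) by (simp_all add: proper_fun_def)
  have le1: "f xs + g zs + ereal (\<eta> \<bullet> (A xs - zs)) \<le> f xs + g zs + ereal (ys \<bullet> (A xs - zs))"
    and le2: "f xs + g zs + ereal (ys \<bullet> (A xs - zs)) \<le> f \<xi> + g \<zeta> + ereal (ys \<bullet> (A \<xi> - \<zeta>))"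
    for \<eta> \<xi> \<zeta>
    using saddle by (auto simp: saddle_point_def lagrangian_def)
  obtain x0 z0 where "f x0 \<noteq> \<infinity>" "g z0 \<noteq> \<infinity>"
    using assms(1,2) by (auto simp: proper_fun_def)
  with le2[of x0 z0] have "f xs \<noteq> \<infinity>" "g zs \<noteq> \<infinity>"
    by auto
  with not_minf(1)[of xs] not_minf(2)[of zs] obtain a b where ab: "f xs = ereal a" "g zs = ereal b"
    by (cases "f xs"; cases "g zs") auto
  \<comment> \<open>Moving the multiplier along the residual raises the Lagrangian by the squared
    norm of the residual, which the saddle property forbids unless the residual vanishes.\<close>
  have "(ys + (A xs - zs)) \<bullet> (A xs - zs) \<le> ys \<bullet> (A xs - zs)"
    using le1[of "ys + (A xs - zs)"] by (simp add: ab)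
  then have "(A xs - zs) \<bullet> (A xs - zs) \<le> 0"
    by (simp add: inner_add_left)
  then show feasible: "A xs = zs"
    by (metis inner_gt_zero_iff not_less right_minus_eq)
  \<comment> \<open>Fixing \<open>zs\<close> and varying only the first variable isolates
    \<open>f\<close>; below, fixing \<open>xs\<close> isolates \<open>g\<close>.\<close>
  have "f xs + ereal (- adjoint A ys \<bullet> (w - xs)) \<le> f w" for w
    using le2[of w zs] not_minf(1)[of w]
    by (cases "f w") (auto simp: ab ab(2)[folded feasible] feasible[symmetric] adjoint_clauses(2)[OF assms(3)]
        linear_diff[OF assms(3)] inner_diff_right)
  then show "- adjoint A ys \<in> subdifferential f xs"
    by (simp add: subdifferential_def ab)
  have "g zs + ereal (ys \<bullet> (w - zs)) \<le> g w" for w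
    using le2[of xs w] not_minf(2)[of w]
    by (cases "g w") (auto simp: ab feasible inner_diff_right)
  then show "ys \<in> subdifferential g zs"
    by (simp add: subdifferential_def ab)
qed

text \<open>Fermat's rule for both subproblems, rewritten with the multiplier update. The
  x-subproblem penalizes against the old \<open>z k\<close> while \<open>y (k + 1)\<close> contains
  the new one, hence the correction \<open>c *\<^sub>R (z (k + 1) - z k)\<close> for
  \<open>f\<close> only.\<close>

lemma adpmm_subgradients:
  assumes "proper_fun f" and "convex_ereal f" and "proper_fun g" and "convex_ereal g"
    and "linear A" and "sym_pos_semidef M1" and "sym_pos_semidef M2" and "c > 0"
    and adpmm: "adpmm_sequence f g A M1 M2 c x z y"
  shows "- adjoint A (y (k + 1) + c *\<^sub>R (z (k + 1) - z k)) - M1 *v (x (k + 1) - x k)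
           \<in> subdifferential f (x (k + 1))"
    and "y (k + 1) - M2 *v (z (k + 1) - z k) \<in> subdifferential g (z (k + 1))"
proof -
  have y: "y (k + 1) = y k + c *\<^sub>R (A (x (k + 1)) - z (k + 1))"
    using adpmm by (simp add: adpmm_sequence_def)
  have "x (k + 1) \<in> argmin (\<lambda>w. f w + ereal (c / 2 * (norm (A w + (inverse c *\<^sub>R y k - z k)))\<^sup>2
      + 1 / 2 * sqnorm M1 (w - x k)))"
    using adpmm by (simp add: adpmm_sequence_def algebra_simps)
  moreover have "((\<lambda>w. c / 2 * (norm (A w + (inverse c *\<^sub>R y k - z k)))\<^sup>2
      + 1 / 2 * sqnorm M1 (w - x k)) has_derivative
      (\<lambda>h. (adjoint A (c *\<^sub>R (A (x (k + 1)) + (inverse c *\<^sub>R y k - z k)))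
        + M1 *v (x (k + 1) - x k)) \<bullet> h)) (at (x (k + 1)))"
    unfolding inner_add_left
    by (intro has_derivative_add has_derivative_half_norm_affine has_derivative_sqnorm assms)
  ultimately have "- (adjoint A (c *\<^sub>R (A (x (k + 1)) + (inverse c *\<^sub>R y k - z k)))
      + M1 *v (x (k + 1) - x k)) \<in> subdifferential f (x (k + 1))"
    by (rule argmin_add_imp_subgradient[OF assms(1,2)])
  moreover have "c *\<^sub>R (A (x (k + 1)) + (inverse c *\<^sub>R y k - z k))
      = y (k + 1) + c *\<^sub>R (z (k + 1) - z k)"
    using \<open>c > 0\<close> by (simp add: y[simplified] algebra_simps)
  ultimately show "- adjoint A (y (k + 1) + c *\<^sub>R (z (k + 1) - z k)) - M1 *v (x (k + 1) - x k)
           \<in> subdifferential f (x (k + 1))"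
    by simp
  have "z (k + 1) \<in> argmin (\<lambda>\<zeta>. g \<zeta> + ereal (c / 2 * (norm (A (x (k + 1)) - \<zeta> + inverse c *\<^sub>R y k))\<^sup>2)
      + ereal (1 / 2 * sqnorm M2 (\<zeta> - z k)))"
    using adpmm unfolding adpmm_sequence_def by blast
  then have "z (k + 1) \<in> argmin (\<lambda>w. g w
      + ereal (c / 2 * (norm (- w + (A (x (k + 1)) + inverse c *\<^sub>R y k)))\<^sup>2
      + 1 / 2 * sqnorm M2 (w - z k)))"
    by (simp add: algebra_simps)
  moreover have "((\<lambda>w. c / 2 * (norm (- w + (A (x (k + 1)) + inverse c *\<^sub>R y k)))\<^sup>2
      + 1 / 2 * sqnorm M2 (w - z k)) has_derivative
      (\<lambda>h. (adjoint uminus (c *\<^sub>R (- z (k + 1) + (A (x (k + 1)) + inverse c *\<^sub>R y k)))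
        + M2 *v (z (k + 1) - z k)) \<bullet> h)) (at (z (k + 1)))"
    unfolding inner_add_left
    by (intro has_derivative_add has_derivative_half_norm_affine has_derivative_sqnorm assms
        linear_uminus)
  ultimately have "- (adjoint uminus (c *\<^sub>R (- z (k + 1) + (A (x (k + 1)) + inverse c *\<^sub>R y k)))
      + M2 *v (z (k + 1) - z k)) \<in> subdifferential g (z (k + 1))"
    by (rule argmin_add_imp_subgradient[OF assms(3,4)])
  \<comment> \<open>Negation is self-adjoint, so its sign cancels the one from Fermat's rule and the
    multiplier enters with a plus sign.\<close>
  moreover have "adjoint uminus = (uminus :: real^'b \<Rightarrow> real^'b)"
    by (rule adjoint_unique) simp
  moreover have "c *\<^sub>R (- z (k + 1) + (A (x (k + 1)) + inverse c *\<^sub>R y k)) = y (k + 1)"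
    using \<open>c > 0\<close> by (simp add: y[simplified] algebra_simps)
  ultimately show "y (k + 1) - M2 *v (z (k + 1) - z k) \<in> subdifferential g (z (k + 1))"
    by simp
qed

theorem mainTheorem1:
  fixes f :: "real^'n \<Rightarrow> ereal" and g :: "real^'m \<Rightarrow> ereal"
    and A :: "real^'n \<Rightarrow> real^'m"
    and M1 :: "real^'n^'n" and M2 :: "real^'m^'m" and c :: real
    and xs :: "real^'n" and zs ys :: "real^'m"
    and x :: "nat \<Rightarrow> real^'n" and z y :: "nat \<Rightarrow> real^'m"
    and u v :: "nat \<Rightarrow> real"
  assumes "proper_fun f" and "convex_ereal f" and "lower_semicontinuous f"
    and "proper_fun g" and "convex_ereal g" and "lower_semicontinuous g"
    and "linear A"
    and "sym_pos_semidef M1" and "sym_pos_semidef M2"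
    and "c > 0"
    and "saddle_point (lagrangian f g A) xs zs ys"
    and "adpmm_sequence f g A M1 M2 c x z y"
    and v_def: "\<And>k. v (k + 1) = sqnorm M1 (x (k + 1) - x k)
          + sqnorm (M2 + c *\<^sub>R mat 1) (z (k + 1) - z k)
          + inverse c * (norm (y (k + 1) - y k))\<^sup>2"
    and u_def: "\<And>k. k \<ge> 1 \<Longrightarrow> u k = sqnorm M1 (xs - x k)
          + sqnorm (M2 + c *\<^sub>R mat 1) (zs - z k)
          + inverse c * (norm (ys - y k))\<^sup>2
          + sqnorm M2 (z k - z (k - 1))"
  shows "\<forall>k\<ge>1. v (k + 1) \<le> u k - u (k + 1)"
proof (intro allI impI)
  fix k :: nat
  assume k: "k \<ge> 1"
  note opt = saddle_point_optimality[OF assms(1,4,7,11)]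
  note sub = adpmm_subgradients[OF assms(1,2,4,5,7,8,9,10,12)]
  define X X' Z Z' Y Y' where "X = x k" and "X' = x (k + 1)" and "Z = z k" and "Z' = z (k + 1)"
    and "Y = y k" and "Y' = y (k + 1)"
  note defs = X_def X'_def Z_def Z'_def Y_def Y'_def
  have y: "Y' = Y + c *\<^sub>R (A X' - Z')"
    using assms(12) by (simp add: adpmm_sequence_def defs)
  \<comment> \<open>The multiplier update is solved for \<open>A X'\<close>, and feasibility
    replaces \<open>A xs\<close> by \<open>zs\<close>; this expresses the f-estimate through y- and
    z-differences.\<close>
  then have residual: "A X' - A xs = inverse c *\<^sub>R (Y' - Y) + (Z' - zs)"
    using \<open>c > 0\<close> by (simp add: opt(1))
  have "0 \<le> (- adjoint A (Y' + c *\<^sub>R (Z' - Z)) - M1 *v (X' - X) - - adjoint A ys) \<bullet> (X' - xs)"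
    unfolding defs by (rule subdifferential_monotone[OF sub(1) opt(2)])
  then have "0 \<le> - ((Y' - ys + c *\<^sub>R (Z' - Z)) \<bullet> (A X' - A xs)) - (M1 *v (X' - X)) \<bullet> (X' - xs)"
    by (simp add: inner_diff_left inner_add_left adjoint_clauses(2)[OF assms(7)]
        linear_diff[OF assms(7)])
  moreover have "(Y' - ys + c *\<^sub>R (Z' - Z)) \<bullet> (A X' - A xs)
      = inverse c * ((Y' - Y) \<bullet> (Y' - ys)) + (Y' - ys) \<bullet> (Z' - zs)
        + (Z' - Z) \<bullet> (Y' - Y) + c * ((Z' - Z) \<bullet> (Z' - zs))"
    using \<open>c > 0\<close> unfolding residual
    by (simp add: inner_add_left inner_add_right inner_commute[of "Y' - ys" "Y' - Y"] distrib_left)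
  ultimately have f_mono: "inverse c * ((Y' - Y) \<bullet> (Y' - ys)) + (Y' - ys) \<bullet> (Z' - zs)
        + (Z' - Z) \<bullet> (Y' - Y) + c * ((Z' - Z) \<bullet> (Z' - zs)) + (M1 *v (X' - X)) \<bullet> (X' - xs) \<le> 0"
    by linarith
  have "0 \<le> (Y' - M2 *v (Z' - Z) - ys) \<bullet> (Z' - zs)"
    unfolding defs by (rule subdifferential_monotone[OF sub(2) opt(3)])
  then have g_mono: "(M2 *v (Z' - Z)) \<bullet> (Z' - zs) \<le> (Y' - ys) \<bullet> (Z' - zs)"
    by (simp add: inner_diff_left)
  \<comment> \<open>The inclusion for \<open>g\<close> at index \<open>k - 1\<close> concerns
    \<open>z k\<close>, which for \<open>k \<ge> 1\<close> is the result of an update and not the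
    arbitrary starting point.\<close>
  have "Y - M2 *v (Z - z (k - 1)) \<in> subdifferential g Z"
    using sub(2)[of "k - 1"] k by (simp add: defs)
  from subdifferential_monotone[OF sub(2)[of k, folded defs] this]
  have "sqnorm M2 (Z' - Z) - (M2 *v (Z - z (k - 1))) \<bullet> (Z' - Z) \<le> (Z' - Z) \<bullet> (Y' - Y)"
    by (simp add: sqnorm_def inner_diff_left inner_diff_right inner_commute)
  \<comment> \<open>After doubling, the Young bound uses up one of the two copies of
    \<open>sqnorm M2 (Z' - Z)\<close>; the other becomes the last term of
    \<open>u (k + 1)\<close>.\<close>
  with sqnorm_young[OF assms(9), of "Z - z (k - 1)" "Z' - Z"]
  have cross: "sqnorm M2 (Z' - Z) - sqnorm M2 (Z - z (k - 1)) \<le> 2 * ((Z' - Z) \<bullet> (Y' - Y))"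
    by linarith
  \<comment> \<open>Twice the f-estimate, in which \<open>g_mono\<close> replaces the product of
    \<open>Y' - ys\<close> and \<open>Z' - zs\<close>, and \<open>cross\<close> the mixed
    term.\<close>
  have "inverse c * (2 * ((Y' - Y) \<bullet> (Y' - ys))) + c * (2 * ((Z' - Z) \<bullet> (Z' - zs)))
      + 2 * ((M1 *v (X' - X)) \<bullet> (X' - xs)) + 2 * ((M2 *v (Z' - Z)) \<bullet> (Z' - zs))
      + (sqnorm M2 (Z' - Z) - sqnorm M2 (Z - z (k - 1))) \<le> 0"
    using f_mono g_mono cross by linarith
  \<comment> \<open>The three-point identities rewrite the left-hand side as exactly
    \<open>v (k + 1) + u (k + 1) - u k\<close>.\<close>
  then show "v (k + 1) \<le> u k - u (k + 1)"
    unfolding norm_three_point sqnorm_three_point[OF assms(8)] sqnorm_three_point[OF assms(9)]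
    using k by (simp add: v_def[of k, simplified] u_def sqnorm_add_scaled_id defs ring_distribs)
qed

end
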